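(* Let $n,k\ge 1$ be integers, let $\epsilon\in(0,1)$ be arbitrary, and let $P\subseteq[0,1]^n$ be a polytope such that the inequality $\sum_{i\in[n]}x_i\le k-\epsilon$ is valid for $P$. Let $\mathcal{T}^{\pi,k}$ be a skewed $k$-tree (for any permutation $\pi$ of $[n]$). Then $\mathcal{T}^{\pi,k}(P)=P_I$. Furthermore, for every integer $n\ge1$ and every integer $q\ge 3$, there exists a polytope $P\subseteq[0,1]^n$ such that $\sum_{i\in[n]}x_i\le 2-\frac{2}{q}$ is valid for $P$, yet $SA^{\lfloor n(q-2)/(q-1)\rfloor}(P)\ne P_I$.
   Context: $[n]=\{1,\dots,n\}$. For a polytope $P\subseteq[0,1]^n$, $P_I:=\mathrm{conv}(P\cap\{0,1\}^n)$. A branch-and-bound (BB) tree $\mathcal{T}$ is a rooted binary tree in which each node has $0$ or $2$ children. Each node $v$ carries a set $C_v$ of branching constraints. The root has $C_{\mathrm{root}}=\emptyset$. If a node $v$ has two children, they are obtained by branching on a variable $x_j$, $j\in[n]$, not already branched on at an ancestor of $v$: one child has branching constraints $C_v\cup\{x_j=0\}$ and the other $C_v\cup\{x_j=1\}$. Write $J_v^1:=\{j:\{x_j=1\}\in C_v\}$. For a polytope $P$, the atom of $v$ is $P_v:=P\cap\{x:C_v\}$ (points of $P$ satisfying all constraints in $C_v$), and $\mathcal{T}(P):=\mathrm{conv}\big(\bigcup_{v\in\mathrm{leaves}(\mathcal{T})}P_v\big)$. Skewed $k$-tree $\mathcal{T}^{\pi,k}$: Let $\mathcal{T}_0$ consist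 of only the root. For $i=1,\dots,n$ in order, $\mathcal{T}_i$ is obtained from $\mathcal{T}_{i-1}$ by branching on variable $x_{\pi(i)}$ at every leaf $v$ of $\mathcal{T}_{i-1}$ with $|J_v^1|<k$ (other leaves are left unchanged). Set $\mathcal{T}^{\pi,k}:=\mathcal{T}_n$. Sherali-Adams: let $P$ be described by a finite system of linear inequalities that includes $0\le x_i\le 1$ for $i\in[n]$. For each inequality $ax-b\ge0$ of the system and each pair of disjoint sets $I,J\subseteq[n]$ with $|I|+|J|\le k$, form $(ax-b)\prod_{i\in I}x_i\prod_{j\in J}(1-x_j)\ge 0$, expand, replace each $x_i^2$ by $x_i$, and replace each monomial $\prod_{i\in S}x_i$ by a variable $y_S$, with $y_\emptyset=1$ and $y_{\{i\}}=x_i$. $SA^k(P)$ is the projection onto the $x$-space of the polyhedron defined by the resulting linear inequalities; $SA^0(P)=P$. *)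

theory Defs
  imports "HOL-Analysis.Analysis" "HOL-Library.Poly_Mapping"
begin

definition unit_cube :: "(real ^ 'n) set" where
  "unit_cube = {x. \<forall>i. 0 \<le> x $ i \<and> x $ i \<le> 1}"

definition integer_hull :: "(real ^ 'n) set \<Rightarrow> (real ^ 'n) set" where
  "integer_hull P = convex hull (P \<inter> {x. \<forall>i. x $ i \<in> {0, 1}})"


section \<open>Branch-and-bound trees\<close>

text \<open>
  In \<open>Branch j l r\<close> the left child is obtained by adding \<open>x\<^sub>j = 0\<close> and the right child by adding
  \<open>x\<^sub>j = 1\<close>.  A branching constraint \<open>x\<^sub>j = 0\<close> or \<open>x\<^sub>j = 1\<close> is the pair \<open>(j, False)\<close> or
  \<open>(j, True)\<close>.  The argument \<open>C\<close> of the functions below is the set of branching constraints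
  of the root of the subtree at hand; it is empty for a whole tree.
\<close>

datatype 'n bb_tree = Leaf | Branch 'n "'n bb_tree" "'n bb_tree"

type_synonym 'n constraints = "('n \<times> bool) set"

fun bb_tree_wf :: "'n constraints \<Rightarrow> 'n bb_tree \<Rightarrow> bool" where
  "bb_tree_wf C Leaf \<longleftrightarrow> True"
| "bb_tree_wf C (Branch j l r) \<longleftrightarrow>
     j \<notin> fst ` C \<and> bb_tree_wf (insert (j, False) C) l \<and> bb_tree_wf (insert (j, True) C) r"

fun leaf_constraints :: "'n constraints \<Rightarrow> 'n bb_tree \<Rightarrow> 'n constraints set" where
  "leaf_constraints C Leaf = {C}"
| "leaf_constraints C (Branch j l r) =
     leaf_constraints (insert (j, False) C) l \<union> leaf_constraints (insert (j, True) C) r"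

definition atom :: "(real ^ 'n) set \<Rightarrow> 'n constraints \<Rightarrow> (real ^ 'n) set" where
  "atom P C = P \<inter> {x. \<forall>(j, b) \<in> C. x $ j = of_bool b}"

definition tree_hull :: "'n bb_tree \<Rightarrow> (real ^ 'n) set \<Rightarrow> (real ^ 'n) set" where
  "tree_hull T P = convex hull (\<Union>C \<in> leaf_constraints {} T. atom P C)"

definition ones :: "'n constraints \<Rightarrow> 'n set" where
  "ones C = {j. (j, True) \<in> C}"

fun branch_leaves :: "nat \<Rightarrow> 'n \<Rightarrow> 'n constraints \<Rightarrow> 'n bb_tree \<Rightarrow> 'n bb_tree" where
  "branch_leaves k j C Leaf = (if card (ones C) < k then Branch j Leaf Leaf else Leaf)"
| "branch_leaves k j C (Branch i l r) =
     Branch i (branch_leaves k j (insert (i, False) C) l) (branch_leaves k j (insert (i, True) C) r)"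

primrec skewed_tree_upto :: "(nat \<Rightarrow> 'n) \<Rightarrow> nat \<Rightarrow> nat \<Rightarrow> 'n bb_tree" where
  "skewed_tree_upto \<pi> k 0 = Leaf"
| "skewed_tree_upto \<pi> k (Suc i) = branch_leaves k (\<pi> (Suc i)) {} (skewed_tree_upto \<pi> k i)"

definition skewed_tree :: "(nat \<Rightarrow> 'n::finite) \<Rightarrow> nat \<Rightarrow> 'n bb_tree" where
  "skewed_tree \<pi> k = skewed_tree_upto \<pi> k CARD('n)"

lemma bb_tree_wf_branch_leaves:
  assumes "bb_tree_wf C T" and "j \<notin> fst ` C" and "j \<notin> set_bb_tree T"
  shows "bb_tree_wf C (branch_leaves k j C T)"
  using assms by (induction T arbitrary: C) auto

lemma set_branch_leaves: "set_bb_tree (branch_leaves k j C T) \<subseteq> insert j (set_bb_tree T)"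
  by (induction T arbitrary: C) (fastforce split: if_splits)+

lemma set_skewed_tree_upto: "set_bb_tree (skewed_tree_upto \<pi> k i) \<subseteq> \<pi> ` {1..i}"
proof (induction i)
  case (Suc i)
  have "set_bb_tree (skewed_tree_upto \<pi> k (Suc i)) \<subseteq> insert (\<pi> (Suc i)) (\<pi> ` {1..i})"
    using set_branch_leaves[of k "\<pi> (Suc i)" "{}" "skewed_tree_upto \<pi> k i"] Suc by auto
  also have "\<dots> = \<pi> ` {1..Suc i}"
    by (auto simp: atLeastAtMostSuc_conv)
  finally show ?case .
qed simp

lemma bb_tree_wf_skewed_tree_upto:
  assumes "inj_on \<pi> {1..i}"
  shows "bb_tree_wf {} (skewed_tree_upto \<pi> k i)"
  using assms
proof (induction i)
  case (Suc i)
  have "\<pi> (Suc i) \<notin> \<pi> ` {1..i}"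
    using Suc.prems by (auto simp: atLeastAtMostSuc_conv)
  then have "\<pi> (Suc i) \<notin> set_bb_tree (skewed_tree_upto \<pi> k i)"
    using set_skewed_tree_upto[of \<pi> k i] by blast
  moreover have "bb_tree_wf {} (skewed_tree_upto \<pi> k i)"
    using Suc by (auto simp: atLeastAtMostSuc_conv)
  ultimately show ?case
    by (simp add: bb_tree_wf_branch_leaves)
qed simp

lemma bb_tree_wf_skewed_tree:
  fixes \<pi> :: "nat \<Rightarrow> 'n::finite"
  assumes "bij_betw \<pi> {1..CARD('n)} UNIV"
  shows "bb_tree_wf {} (skewed_tree \<pi> k)"
  using assms unfolding skewed_tree_def
  by (intro bb_tree_wf_skewed_tree_upto) (rule bij_betw_imp_inj_on)


section \<open>The Sherali-Adams hierarchy\<close>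

text \<open>The pair \<open>(a, b)\<close> stands for the inequality \<open>a x - b \<ge> 0\<close>.\<close>

type_synonym 'n lin_system = "((real ^ 'n) \<times> real) set"

definition describes :: "('n::finite) lin_system \<Rightarrow> (real ^ 'n) set \<Rightarrow> bool" where
  "describes Sys P \<longleftrightarrow>
     finite Sys \<and>
     (\<forall>i. (axis i 1, 0) \<in> Sys \<and> (- axis i 1, -1) \<in> Sys) \<and>
     P = {x. \<forall>(a, b) \<in> Sys. a \<bullet> x - b \<ge> 0}"

text \<open>
  Multivariate real polynomials are finitely supported maps from exponent vectors to
  coefficients, multiplied by convolution.
\<close>

type_synonym 'n mpolynomial = "('n \<Rightarrow>\<^sub>0 nat) \<Rightarrow>\<^sub>0 real"

definition pvar :: "'n \<Rightarrow> 'n mpolynomial" where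
  "pvar i = Poly_Mapping.single (Poly_Mapping.single i 1) 1"

definition pconst :: "real \<Rightarrow> 'n mpolynomial" where
  "pconst c = Poly_Mapping.single 0 c"

definition sa_product :: "(real ^ 'n) \<Rightarrow> real \<Rightarrow> 'n set \<Rightarrow> 'n set \<Rightarrow> ('n::finite) mpolynomial" where
  "sa_product a b I J =
     ((\<Sum>i\<in>UNIV. pconst (a $ i) * pvar i) - pconst b) * (\<Prod>i\<in>I. pvar i) * (\<Prod>j\<in>J. 1 - pvar j)"

text \<open>
  Replacing \<open>x\<^sub>i\<^sup>2\<close> by \<open>x\<^sub>i\<close> turns a monomial into the product of the variables in its support
  \<open>S\<close>, which is then replaced by \<open>y S\<close>.
\<close>

definition linearize :: "('n set \<Rightarrow> real) \<Rightarrow> 'n mpolynomial \<Rightarrow> real" where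
  "linearize y p =
     (\<Sum>m \<in> Poly_Mapping.keys p. Poly_Mapping.lookup p m * y (Poly_Mapping.keys m))"

text \<open>
  Only the values of \<open>y\<close> on sets of at most \<open>k + 1\<close> elements enter the constraints, so quantifying
  over a total \<open>y\<close> gives the same projection.
\<close>

definition sherali_adams :: "nat \<Rightarrow> ('n::finite) lin_system \<Rightarrow> (real ^ 'n) set" where
  "sherali_adams k Sys =
     {x. \<exists>y. y {} = 1 \<and> (\<forall>i. y {i} = x $ i) \<and>
           (\<forall>(a, b) \<in> Sys. \<forall>I J. I \<inter> J = {} \<and> card I + card J \<le> k \<longrightarrow>
              linearize y (sa_product a b I J) \<ge> 0)}"

lemma linearize_superset:
  assumes "finite A" and "Poly_Mapping.keys p \<subseteq> A"
  shows "linearize y p = (\<Sum>m \<in> A. Poly_Mapping.lookup p m * y (Poly_Mapping.keys m))"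
  unfolding linearize_def
  using assms by (intro sum.mono_neutral_left) (auto simp: in_keys_iff)

lemma linearize_add: "linearize y (p + q) = linearize y p + linearize y q"
proof -
  let ?A = "Poly_Mapping.keys p \<union> Poly_Mapping.keys q"
  have "linearize y (p + q) =
      (\<Sum>m \<in> ?A. Poly_Mapping.lookup (p + q) m * y (Poly_Mapping.keys m))"
    by (intro linearize_superset keys_add) simp
  also have "\<dots> = linearize y p + linearize y q"
    by (simp add: linearize_superset[of ?A] lookup_add distrib_right sum.distrib)
  finally show ?thesis .
qed

lemma linearize_zero [simp]: "linearize y 0 = 0"
  by (simp add: linearize_def)

lemma linearize_uminus: "linearize y (- p) = - linearize y p"
  using linearize_add[of y p "- p"] by simp

lemma linearize_diff: "linearize y (p - q) = linearize y p - linearize y q"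
  using linearize_add[of y p "- q"] by (simp add: linearize_uminus)

lemma linearize_sum: "linearize y (sum f A) = (\<Sum>i\<in>A. linearize y (f i))"
  by (induction A rule: infinite_finite_induct) (simp_all add: linearize_add)

lemma linearize_single:
  "linearize y (Poly_Mapping.single m c) = c * y (Poly_Mapping.keys m)"
  by (simp add: linearize_def)

lemma sherali_adams_0:
  assumes "describes Sys P"
  shows "sherali_adams 0 Sys = P"
proof -
  have lin: "linearize y (sa_product a b {} {}) = (\<Sum>i\<in>UNIV. a $ i * y {i}) - b * y {}"
    for y :: "'a set \<Rightarrow> real" and a :: "real ^ 'a" and b
    by (simp add: sa_product_def pvar_def pconst_def mult_single linearize_diff linearize_sum
        linearize_single)
  have "sherali_adams 0 Sys = {x. \<forall>(a, b) \<in> Sys. a \<bullet> x - b \<ge> 0}" (is "?L = ?R")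
  proof
    show "?L \<subseteq> ?R"
      by (auto simp: sherali_adams_def lin inner_vec_def)
    show "?R \<subseteq> ?L"
    proof
      fix x assume "x \<in> ?R"
      then show "x \<in> ?L"
        unfolding sherali_adams_def
        by (intro CollectI exI[of _ "\<lambda>S. if S = {} then 1 else x $ the_elem S"])
           (auto simp: lin inner_vec_def)
    qed
  qed
  with assms show ?thesis
    by (simp add: describes_def)
qed

end

theory Submission imports Defs begin

text \<open>
  The first part rests on a dichotomy for the leaves of a skewed \<open>k\<close>-tree.  Branching stops early
  only at a leaf with at least \<open>k\<close> constraints \<open>x\<^sub>j = 1\<close>, and the atom of such a leaf is empty,
  because its points would have coordinate sum at least \<open>k > k - \<epsilon>\<close>.  Every other leaf fixes all
  the variables, so its atom has only 0/1 points (lemma \<open>skewed_tree_leaf\<close>).  Conversely, no tree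
  loses a 0/1 point of \<open>P\<close>, since branching splits the 0/1 points between the children.

  For the second part, take \<open>P = {x \<in> [0,1]\<^sup>n. 1/2 \<le> \<Sum>\<^sub>i x\<^sub>i \<le> 1}\<close>.  Its 0/1 points are the unit
  vectors, so \<open>\<Sum>\<^sub>i x\<^sub>i = 1\<close> on \<open>P\<^sub>I\<close>.  Consider the uniform distribution on the origin and the \<open>n\<close>
  unit vectors.  Its moments are a Sherali-Adams solution of every level \<open>k < n\<close>: a product of
  literals \<open>x\<^sub>i\<close> and \<open>1 - x\<^sub>j\<close> restricts the distribution to a subcube with at most \<open>k\<close> fixed
  coordinates, and if this subcube contains the infeasible point \<open>0\<close>, then it also contains
  some unit vector \<open>e\<^sub>j\<close>.  The slacks of a valid inequality at \<open>0\<close> and at \<open>e\<^sub>j\<close> add up to twice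
  the slack at \<open>e\<^sub>j / 2 \<in> P\<close>, which is nonnegative; the other unit vectors in the subcube lie in
  \<open>P\<close> and only add nonnegative slacks.  The mean of the distribution has coordinate sum
  \<open>n / (n + 1) < 1\<close> and thus lies outside \<open>P\<^sub>I\<close>.  Only the valid inequalities of \<open>P\<close> enter, so the
  argument covers every linear description of \<open>P\<close>; and the level \<open>\<lfloor>n (q - 2) / (q - 1)\<rfloor>\<close> is below \<open>n\<close>.
\<close>

section \<open>Skewed trees\<close>

lemma leaf_constraints_branch_leaves:
  "leaf_constraints C (branch_leaves k j C T) =
     (\<Union>D \<in> leaf_constraints C T.
        if card (ones D) < k then {insert (j, False) D, insert (j, True) D} else {D})"
  by (induction T arbitrary: C) auto

text \<open>
  A leaf that a step leaves unchanged has at least \<open>k\<close> ones.  So a leaf with fewer than \<open>k\<close> ones is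
  a child created in the last step, its parent had fewer than \<open>k\<close> ones too, and by induction no
  variable was skipped on the way to it.
\<close>

lemma skewed_tree_upto_leaf:
  assumes "C \<in> leaf_constraints {} (skewed_tree_upto \<pi> k i)" and "card (ones C) < k"
  shows "\<pi> ` {1..i} \<subseteq> fst ` C"
  using assms
proof (induction i arbitrary: C)
  case 0
  then show ?case by simp
next
  case (Suc i)
  from Suc.prems obtain D b where D: "D \<in> leaf_constraints {} (skewed_tree_upto \<pi> k i)"
    "card (ones D) < k" "C = insert (\<pi> (Suc i), b) D"
    by (auto simp: leaf_constraints_branch_leaves split: if_splits)
  have "\<pi> ` {1..i} \<subseteq> fst ` D"
    using Suc.IH D by blast
  with D(3) show ?case
    by (auto simp: atLeastAtMostSuc_conv)
qed

lemma skewed_tree_leaf: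
  fixes \<pi> :: "nat \<Rightarrow> 'n::finite"
  assumes "\<pi> ` {1..CARD('n)} = UNIV" and "C \<in> leaf_constraints {} (skewed_tree \<pi> k)"
  shows "k \<le> card (ones C) \<or> fst ` C = UNIV"
  using assms skewed_tree_upto_leaf[of C \<pi> k "CARD('n)"]
  unfolding skewed_tree_def by (metis linorder_not_le top.extremum_unique)

lemma leaf_through_01_point:
  fixes x :: "real ^ 'n::finite"
  assumes "\<forall>i. x $ i \<in> {0, 1}" and "\<forall>(j, b) \<in> C. x $ j = of_bool b"
  shows "\<exists>D \<in> leaf_constraints C T. \<forall>(j, b) \<in> D. x $ j = of_bool b"
  using assms(2)
proof (induction T arbitrary: C)
  case Leaf
  then show ?case by simp
next
  case (Branch j l r)
  consider "x $ j = 0" | "x $ j = 1"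
    using assms(1) by blast
  then show ?case
  proof cases
    case 1
    then show ?thesis
      using Branch.IH(1)[of "insert (j, False) C"] Branch.prems by (simp add: bex_Un)
  next
    case 2
    then show ?thesis
      using Branch.IH(2)[of "insert (j, True) C"] Branch.prems by (simp add: bex_Un)
  qed
qed

lemma card_ones_le_sum_atom:
  fixes P :: "(real ^ 'n::finite) set"
  assumes "P \<subseteq> unit_cube" and "x \<in> atom P C"
  shows "real (card (ones C)) \<le> (\<Sum>i\<in>UNIV. x $ i)"
proof -
  have "real (card (ones C)) = (\<Sum>i\<in>ones C. x $ i)"
  proof -
    have "x $ i = 1" if "i \<in> ones C" for i
      using assms(2) that by (auto simp: atom_def ones_def)
    then show ?thesis
      by simp
  qed
  also have "\<dots> \<le> (\<Sum>i\<in>UNIV. x $ i)"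
    using assms by (intro sum_mono2) (auto simp: atom_def unit_cube_def)
  finally show ?thesis .
qed

lemma skewed_tree_hull:
  fixes P :: "(real ^ 'n::finite) set" and \<pi> :: "nat \<Rightarrow> 'n"
  assumes "P \<subseteq> unit_cube" and sum: "\<And>x. x \<in> P \<Longrightarrow> (\<Sum>i\<in>UNIV. x $ i) < real k"
    and "\<pi> ` {1..CARD('n)} = UNIV"
  shows "tree_hull (skewed_tree \<pi> k) P = integer_hull P"
proof -
  have "(\<Union>C \<in> leaf_constraints {} (skewed_tree \<pi> k). atom P C) = P \<inter> {x. \<forall>i. x $ i \<in> {0, 1}}"
    (is "?L = ?R")
  proof
    show "?L \<subseteq> ?R"
    proof
      fix x assume "x \<in> ?L"
      then obtain C where C: "C \<in> leaf_constraints {} (skewed_tree \<pi> k)" and x: "x \<in> atom P C"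
        by blast
      have "x \<in> P"
        using x by (simp add: atom_def)
      have "\<not> k \<le> card (ones C)"
        using card_ones_le_sum_atom[OF assms(1) x] sum[OF \<open>x \<in> P\<close>] by linarith
      then have fixed: "fst ` C = UNIV"
        using skewed_tree_leaf[OF assms(3) C] by blast
      have "x $ i \<in> {0, 1}" for i
      proof -
        have "i \<in> fst ` C"
          using fixed by simp
        then obtain b where "(i, b) \<in> C"
          by auto
        then show ?thesis
          using x by (cases b) (auto simp: atom_def)
      qed
      with \<open>x \<in> P\<close> show "x \<in> ?R"
        by simp
    qed
    show "?R \<subseteq> ?L"
    proof
      fix x assume x: "x \<in> ?R"
      then have "\<exists>C \<in> leaf_constraints {} (skewed_tree \<pi> k). \<forall>(j, b) \<in> C. x $ j = of_bool b"
        by (intro leaf_through_01_point) auto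
      with x show "x \<in> ?L"
        by (auto simp: atom_def)
    qed
  qed
  then show ?thesis
    by (simp add: tree_hull_def integer_hull_def)
qed


section \<open>Sherali-Adams solutions from distributions on 0/1 points\<close>

text \<open>
  A 0/1 point is represented by its support \<open>U\<close>.  Linearizing with the moments of \<open>U\<close>, that is, with
  \<open>y S = (\<Prod>i\<in>S. x\<^sub>i)\<close>, evaluates a polynomial at this point, since replacing \<open>x\<^sub>i\<^sup>2\<close> by \<open>x\<^sub>i\<close> does not
  change values there.
\<close>

definition eval_01 :: "'n set \<Rightarrow> 'n mpolynomial \<Rightarrow> real" where
  "eval_01 U = linearize (\<lambda>S. of_bool (S \<subseteq> U))"

lemma keys_add_nat:
  fixes f g :: "'n \<Rightarrow>\<^sub>0 nat"
  shows "Poly_Mapping.keys (f + g) = Poly_Mapping.keys f \<union> Poly_Mapping.keys g"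
  by (auto simp: in_keys_iff lookup_add)

lemma eval_01_mult: "eval_01 U (p * q) = eval_01 U p * eval_01 U q"
proof -
  have sums: "p = (\<Sum>m\<in>Poly_Mapping.keys p. Poly_Mapping.single m (Poly_Mapping.lookup p m))"
    for p :: "'a mpolynomial"
    by (rule poly_mapping_eqI)
       (simp add: lookup_sum lookup_single when_def sum.delta in_keys_iff)
  have "eval_01 U (p * q) = eval_01 U
      (\<Sum>m\<in>Poly_Mapping.keys p. \<Sum>m'\<in>Poly_Mapping.keys q.
         Poly_Mapping.single (m + m') (Poly_Mapping.lookup p m * Poly_Mapping.lookup q m'))"
    by (subst sums[of p], subst sums[of q]) (simp add: sum_product mult_single)
  also have "\<dots> = eval_01 U p * eval_01 U q"
    unfolding eval_01_def linearize_sum linearize_single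
    by (simp add: linearize_def keys_add_nat sum_product of_bool_conj mult_ac
        del: sum_mult_of_bool_eq sum_of_bool_mult_eq)
  finally show ?thesis .
qed

lemma eval_01_const: "eval_01 U (pconst c) = c"
  by (simp add: eval_01_def pconst_def linearize_single)

lemma eval_01_var: "eval_01 U (pvar i) = of_bool (i \<in> U)"
  by (simp add: eval_01_def pvar_def linearize_single)

lemma eval_01_one: "eval_01 U 1 = 1"
  using eval_01_const[of U 1] by (simp add: pconst_def)

lemma eval_01_diff: "eval_01 U (p - q) = eval_01 U p - eval_01 U q"
  by (simp add: eval_01_def linearize_diff)

lemma eval_01_sum: "eval_01 U (sum f A) = (\<Sum>i\<in>A. eval_01 U (f i))"
  by (simp add: eval_01_def linearize_sum)

lemma eval_01_prod: "eval_01 U (prod f A) = (\<Prod>i\<in>A. eval_01 U (f i))"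
  by (induction A rule: infinite_finite_induct) (simp_all add: eval_01_mult eval_01_one)

lemma prod_of_bool: "finite A \<Longrightarrow> (\<Prod>i\<in>A. of_bool (Q i)) = (of_bool (\<forall>i\<in>A. Q i) :: real)"
  by (induction A rule: finite_induct) auto

lemma eval_01_sa_product:
  fixes a :: "real ^ 'n::finite"
  shows "eval_01 U (sa_product a b I J) =
    ((\<Sum>i\<in>U. a $ i) - b) * of_bool (I \<subseteq> U \<and> J \<inter> U = {})"
proof -
  have "eval_01 U (\<Prod>i\<in>I. pvar i) = of_bool (I \<subseteq> U)"
    by (simp add: eval_01_prod eval_01_var prod_of_bool subset_iff Ball_def)
  moreover have "eval_01 U (1 - pvar j) = of_bool (j \<notin> U)" for j
    by (simp add: eval_01_diff eval_01_one eval_01_var)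
  then have "eval_01 U (\<Prod>j\<in>J. 1 - pvar j) = of_bool (J \<inter> U = {})"
    by (simp add: eval_01_prod prod_of_bool disjoint_iff Ball_def)
  moreover have "(\<Sum>i\<in>UNIV. a $ i * of_bool (i \<in> U)) = (\<Sum>i\<in>U. a $ i)"
    by (simp add: of_bool_def if_distrib sum.If_cases cong: if_cong)
  ultimately show ?thesis
    by (simp add: sa_product_def eval_01_mult eval_01_diff eval_01_sum eval_01_const eval_01_var
        of_bool_conj)
qed

lemma linearize_moments:
  fixes \<mu> :: "'n::finite set \<Rightarrow> real"
  shows "linearize (\<lambda>S. \<Sum>U\<in>UNIV. \<mu> U * of_bool (S \<subseteq> U)) p = (\<Sum>U\<in>UNIV. \<mu> U * eval_01 U p)"
  unfolding linearize_def eval_01_def sum_distrib_left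
  by (subst sum.swap) (simp add: mult_ac)

text \<open>
  The constraint for \<open>I\<close> and \<open>J\<close> only sees the weights \<open>\<mu>\<close> on the subcube \<open>x\<^sub>i = 1\<close> (\<open>i \<in> I\<close>),
  \<open>x\<^sub>j = 0\<close> (\<open>j \<in> J\<close>), because its product of literals is the indicator of this subcube on the 0/1
  points.  So \<open>\<mu>\<close> may charge infeasible points, as long as the weighted slack is nonnegative on
  each subcube with at most \<open>k\<close> fixed coordinates.
\<close>

lemma sherali_adams_distribution:
  fixes \<mu> :: "'n::finite set \<Rightarrow> real" and x :: "real ^ 'n"
  assumes total: "(\<Sum>U\<in>UNIV. \<mu> U) = 1"
    and mean: "\<And>i. x $ i = (\<Sum>U | i \<in> U. \<mu> U)"
    and slack: "\<And>a b I J. (a, b) \<in> Sys \<Longrightarrow> I \<inter> J = {} \<Longrightarrow> card I + card J \<le> k \<Longrightarrow>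
      0 \<le> (\<Sum>U | I \<subseteq> U \<and> J \<inter> U = {}. \<mu> U * ((\<Sum>i\<in>U. a $ i) - b))"
  shows "x \<in> sherali_adams k Sys"
proof -
  define y where "y = (\<lambda>S. \<Sum>U\<in>UNIV. \<mu> U * of_bool (S \<subseteq> U))"
  have indicator: "(\<Sum>U\<in>UNIV. f U * of_bool (Q U)) = (\<Sum>U | Q U. f U)"
    for f :: "'n set \<Rightarrow> real" and Q
    by (simp add: of_bool_def if_distrib sum.If_cases cong: if_cong)
  have "y {} = 1"
    unfolding y_def using total by simp
  moreover have "y {i} = x $ i" for i
    unfolding y_def mean indicator[symmetric] by (simp del: sum_mult_of_bool_eq)
  moreover have "linearize y (sa_product a b I J) \<ge> 0"
    if "(a, b) \<in> Sys" "I \<inter> J = {}" "card I + card J \<le> k" for a b I J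
    using slack[OF that]
    unfolding y_def linearize_moments
    unfolding eval_01_sa_product mult.assoc[symmetric] indicator .
  ultimately show ?thesis
    unfolding sherali_adams_def by blast
qed


section \<open>The uniform distribution on the origin and the unit vectors\<close>

lemma card_le_1_sets: "{U :: 'n::finite set. card U \<le> 1} = insert {} (range (\<lambda>i. {i}))"
  by (auto simp: le_Suc_eq card_1_singleton_iff)

lemma sum_card_le_1:
  fixes g :: "'n::finite set \<Rightarrow> real"
  shows "(\<Sum>U | card U \<le> 1. g U) = g {} + (\<Sum>i\<in>UNIV. g {i})"
  unfolding card_le_1_sets by (subst sum.insert) (auto simp: sum.reindex)

text \<open>
  The hypothesis on \<open>e\<^sub>i / 2\<close> pays for the possibly negative slack at the origin: as fewer than \<open>n\<close>
  coordinates are fixed to \<open>0\<close>, some unit vector shares the subcube with it.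
\<close>

lemma uniform_mean_in_sherali_adams:
  fixes Sys :: "('n::finite) lin_system"
  assumes unit: "\<And>a b i. (a, b) \<in> Sys \<Longrightarrow> a $ i \<ge> b"
    and half: "\<And>a b i. (a, b) \<in> Sys \<Longrightarrow> a $ i / 2 \<ge> b"
    and k: "k < CARD('n)"
  shows "(\<chi> i. 1 / (real CARD('n) + 1)) \<in> sherali_adams k Sys"
proof (rule sherali_adams_distribution)
  define w where "w = 1 / (real CARD('n) + 1)"
  have w: "w > 0"
    by (simp add: w_def add_pos_nonneg)
  define \<mu> where "\<mu> = (\<lambda>U :: 'n set. if card U \<le> 1 then w else 0)"
  have weigh: "(\<Sum>U | Q U. \<mu> U * g U) =
      w * (of_bool (Q {}) * g {} + (\<Sum>i\<in>UNIV. of_bool (Q {i}) * g {i}))"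
    for Q and g :: "'n set \<Rightarrow> real"
  proof -
    have "(\<Sum>U | Q U. \<mu> U * g U) = (\<Sum>U | card U \<le> 1. w * (of_bool (Q U) * g U))"
      by (intro sum.mono_neutral_cong) (auto simp: \<mu>_def)
    then show ?thesis
      by (simp only: sum_card_le_1 distrib_left sum_distrib_left)
  qed
  show "(\<Sum>U\<in>UNIV. \<mu> U) = 1"
    using weigh[where Q = "\<lambda>_. True" and g = "\<lambda>_. 1"] by (simp add: w_def field_simps)
  show "(\<chi> i. 1 / (real CARD('n) + 1)) $ i = (\<Sum>U | i \<in> U. \<mu> U)" for i :: 'n
    using weigh[where Q = "\<lambda>U. i \<in> U" and g = "\<lambda>_. 1"] by (simp add: w_def)
  fix a b and I J :: "'n set"
  assume ab: "(a, b) \<in> Sys" and "I \<inter> J = {}" and IJ: "card I + card J \<le> k"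
  let ?Q = "\<lambda>U. I \<subseteq> U \<and> J \<inter> U = {}"
  let ?g = "\<lambda>U. (\<Sum>i\<in>U. a $ i) - b"
  have nonneg: "0 \<le> of_bool (?Q {i}) * ?g {i}" for i
    using unit[OF ab, of i] by simp
  have "0 \<le> of_bool (?Q {}) * ?g {} + (\<Sum>i\<in>UNIV. of_bool (?Q {i}) * ?g {i})"
  proof (cases "I = {}")
    case True
    have "J \<noteq> UNIV"
      using IJ k by auto
    then obtain j where j: "j \<notin> J"
      by blast
    have "0 \<le> ?g {} + ?g {j}"
      using half[OF ab, of j] by simp
    also have "\<dots> = of_bool (?Q {}) * ?g {} + of_bool (?Q {j}) * ?g {j}"
      using True j by simp
    also have "\<dots> \<le> of_bool (?Q {}) * ?g {} + (\<Sum>i\<in>UNIV. of_bool (?Q {i}) * ?g {i})"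
      using nonneg by (intro add_left_mono member_le_sum) auto
    finally show ?thesis .
  next
    case False
    then show ?thesis
      using sum_nonneg[of UNIV "\<lambda>i. of_bool (?Q {i}) * ?g {i}"] nonneg by simp
  qed
  with w show "0 \<le> (\<Sum>U | ?Q U. \<mu> U * ?g U)"
    unfolding weigh by (rule mult_nonneg_nonneg[OF less_imp_le])
qed


section \<open>The slab between \<open>\<Sum> x = 1/2\<close> and \<open>\<Sum> x = 1\<close>\<close>

definition slab :: "(real ^ 'n::finite) set" where
  "slab = {x \<in> unit_cube. 1 / 2 \<le> (\<Sum>i\<in>UNIV. x $ i) \<and> (\<Sum>i\<in>UNIV. x $ i) \<le> 1}"

lemma describes_imp_subset_unit_cube:
  assumes "describes Sys P"
  shows "P \<subseteq> unit_cube"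
proof
  fix x assume "x \<in> P"
  then have x: "a \<bullet> x - b \<ge> 0" if "(a, b) \<in> Sys" for a b
    using assms that by (auto simp: describes_def)
  have "(axis i 1, 0) \<in> Sys" "(- axis i 1, -1) \<in> Sys" for i
    using assms by (auto simp: describes_def)
  from this[THEN x] show "x \<in> unit_cube"
    by (simp add: unit_cube_def inner_axis')
qed

lemma describes_imp_polytope:
  fixes P :: "(real ^ 'n::finite) set"
  assumes "describes Sys P"
  shows "polytope P"
proof -
  have "polyhedron (\<Inter> ((\<lambda>(a, b). {x. a \<bullet> x \<ge> b}) ` Sys))"
    using assms by (intro polyhedron_Inter) (auto simp: describes_def polyhedron_halfspace_ge)
  moreover have "P = \<Inter> ((\<lambda>(a, b). {x. a \<bullet> x \<ge> b}) ` Sys)"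
    using assms by (auto simp: describes_def)
  ultimately have "polyhedron P"
    by simp
  moreover have "bounded (unit_cube :: (real ^ 'n) set)"
    by (rule bounded_subset[where T = "cbox 0 (\<chi> i. 1)"]) (auto simp: unit_cube_def mem_box_cart)
  ultimately show ?thesis
    using describes_imp_subset_unit_cube[OF assms] bounded_subset
    by (auto simp: polytope_eq_bounded_polyhedron)
qed

lemma slab_describable: "\<exists>Sys. describes Sys (slab :: (real ^ 'n::finite) set)"
proof -
  let ?Sys = "range (\<lambda>i. (axis i 1, 0)) \<union> range (\<lambda>i. (- axis i 1, -1)) \<union>
    {(\<chi> i. 1, 1 / 2), (\<chi> i. -1, -1)} :: 'n lin_system"
  have "(\<chi> i. 1) \<bullet> x = (\<Sum>i\<in>UNIV. x $ i)"
    and "(\<chi> i. -1) \<bullet> x = - (\<Sum>i\<in>UNIV. x $ i)" for x :: "real ^ 'n"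
    by (simp_all add: inner_vec_def sum_negf)
  then have "slab = {x. \<forall>(a, b) \<in> ?Sys. a \<bullet> x - b \<ge> 0}"
    by (simp add: slab_def unit_cube_def inner_axis' ball_Un conj_ac all_conj_distrib)
  then have "describes ?Sys slab"
    by (auto simp: describes_def)
  then show ?thesis ..
qed

text \<open>At a 0/1 point the coordinate sum is an integer, and \<open>1\<close> is the only one in \<open>[1/2, 1]\<close>.\<close>

lemma sum_integer_hull_slab:
  fixes x :: "real ^ 'n::finite"
  assumes "x \<in> integer_hull slab"
  shows "(\<Sum>i\<in>UNIV. x $ i) = 1"
proof -
  have "integer_hull slab \<subseteq> {x :: real ^ 'n. (\<chi> i. 1) \<bullet> x = 1}"
    unfolding integer_hull_def
  proof (rule hull_minimal)
    show "slab \<inter> {x. \<forall>i. x $ i \<in> {0, 1}} \<subseteq> {x :: real ^ 'n. (\<chi> i. 1) \<bullet> x = 1}"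
    proof
      fix x :: "real ^ 'n"
      assume x: "x \<in> slab \<inter> {x. \<forall>i. x $ i \<in> {0, 1}}"
      have "(\<Sum>i\<in>UNIV. x $ i) \<in> \<int>"
      proof (rule Ints_sum)
        show "x $ i \<in> \<int>" for i
          using x by (cases "x $ i = 0") auto
      qed
      then obtain m where m: "(\<Sum>i\<in>UNIV. x $ i) = of_int m"
        by (auto elim: Ints_cases)
      with x have "1 / 2 \<le> real_of_int m" "real_of_int m \<le> 1"
        by (auto simp: slab_def)
      then have "m = 1"
        by linarith
      with m show "x \<in> {x. (\<chi> i. 1) \<bullet> x = 1}"
        by (simp add: inner_vec_def)
    qed
  qed (rule convex_hyperplane)
  with assms show ?thesis
    by (auto simp: inner_vec_def)
qed

lemma sherali_adams_slab_neq_integer_hull: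
  fixes Sys :: "('n::finite) lin_system"
  assumes Sys: "describes Sys slab" and k: "k < CARD('n)"
  shows "sherali_adams k Sys \<noteq> integer_hull slab"
proof -
  have valid: "a \<bullet> x \<ge> b" if "(a, b) \<in> Sys" "x \<in> slab" for a b x
    using Sys that by (auto simp: describes_def)
  have scaled: "t *\<^sub>R axis i 1 \<in> (slab :: (real ^ 'n) set)" if "1 / 2 \<le> t" "t \<le> 1" for i t
    using that by (simp add: slab_def unit_cube_def axis_def if_distrib cong: if_cong)
  let ?x = "\<chi> i. 1 / (real CARD('n) + 1) :: real ^ 'n"
  have "?x \<in> sherali_adams k Sys"
  proof (rule uniform_mean_in_sherali_adams[OF _ _ k])
    show "a $ i \<ge> b" if "(a, b) \<in> Sys" for a b i
      using valid[OF that scaled[of 1 i]] by (simp add: inner_axis)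
    show "a $ i / 2 \<ge> b" if "(a, b) \<in> Sys" for a b i
      using valid[OF that scaled[of "1 / 2" i]] by (simp add: inner_axis)
  qed
  moreover have "?x \<notin> integer_hull slab"
    using sum_integer_hull_slab[of ?x] by auto
  ultimately show ?thesis
    by metis
qed

lemma sherali_adams_level_less:
  assumes "q \<ge> 3" and "n > 0"
  shows "nat \<lfloor>real n * (real q - 2) / (real q - 1)\<rfloor> < n"
proof -
  have "real n * (real q - 2) / (real q - 1) < real n"
    using assms by (simp add: divide_less_eq)
  then show ?thesis
    using assms(2) by linarith
qed


section \<open>Skewed trees against the Sherali-Adams hierarchy\<close>

theorem theorem4:
  shows
    "(\<forall>(k::nat) (\<epsilon>::real) (P :: (real ^ 'n::finite) set) (\<pi> :: nat \<Rightarrow> 'n).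
        1 \<le> k \<and> 0 < \<epsilon> \<and> \<epsilon> < 1 \<and>
        polytope P \<and> P \<subseteq> unit_cube \<and> (\<forall>x\<in>P. (\<Sum>i\<in>UNIV. x $ i) \<le> real k - \<epsilon>) \<and>
        bij_betw \<pi> {1..CARD('n)} UNIV
        \<longrightarrow> tree_hull (skewed_tree \<pi> k) P = integer_hull P)
     \<and>
     (\<forall>q::nat. 3 \<le> q \<longrightarrow>
        (\<exists>P :: (real ^ 'n) set.
           polytope P \<and> P \<subseteq> unit_cube \<and> (\<forall>x\<in>P. (\<Sum>i\<in>UNIV. x $ i) \<le> 2 - 2 / real q) \<and>
           (\<exists>Sys. describes Sys P) \<and>
           (\<forall>Sys. describes Sys P \<longrightarrow>
              sherali_adams (nat \<lfloor>real CARD('n) * (real q - 2) / (real q - 1)\<rfloor>) Sys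
                \<noteq> integer_hull P)))"
proof (intro conjI allI impI)
  fix k :: nat and \<epsilon> :: real and P :: "(real ^ 'n) set" and \<pi> :: "nat \<Rightarrow> 'n"
  assume A: "1 \<le> k \<and> 0 < \<epsilon> \<and> \<epsilon> < 1 \<and>
    polytope P \<and> P \<subseteq> unit_cube \<and> (\<forall>x\<in>P. (\<Sum>i\<in>UNIV. x $ i) \<le> real k - \<epsilon>) \<and>
    bij_betw \<pi> {1..CARD('n)} UNIV"
  show "tree_hull (skewed_tree \<pi> k) P = integer_hull P"
  proof (rule skewed_tree_hull)
    show "(\<Sum>i\<in>UNIV. x $ i) < real k" if "x \<in> P" for x
      using A that by fastforce
  qed (use A in \<open>auto simp: bij_betw_def\<close>)
next
  fix q :: nat
  assume q: "3 \<le> q"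
  obtain Sys where Sys: "describes Sys (slab :: (real ^ 'n) set)"
    using slab_describable by blast
  have "1 \<le> 2 - 2 / real q"
    using q by (simp add: field_simps)
  then have "(\<Sum>i\<in>UNIV. x $ i) \<le> 2 - 2 / real q" if "x \<in> slab" for x :: "real ^ 'n"
    using that by (auto simp: slab_def)
  moreover have "nat \<lfloor>real CARD('n) * (real q - 2) / (real q - 1)\<rfloor> < CARD('n)"
    using q by (intro sherali_adams_level_less) auto
  ultimately show "\<exists>P :: (real ^ 'n) set.
      polytope P \<and> P \<subseteq> unit_cube \<and> (\<forall>x\<in>P. (\<Sum>i\<in>UNIV. x $ i) \<le> 2 - 2 / real q) \<and>
      (\<exists>Sys. describes Sys P) \<and>
      (\<forall>Sys. describes Sys P \<longrightarrow>
         sherali_adams (nat \<lfloor>real CARD('n) * (real q - 2) / (real q - 1)\<rfloor>) Sys \<noteq> integer_hull P)"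
    using Sys describes_imp_polytope[OF Sys] describes_imp_subset_unit_cube[OF Sys]
      sherali_adams_slab_neq_integer_hull
    by (intro exI[of _ slab]) blast
qed

end
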